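(* Let $b>0$, $r_h>0$ and $\varepsilon\in\{+1,-1\}$. Let $(m,S,w)$ be a solution on the exterior domain $r\ge r_h$ of the reduced static spherically symmetric logarithmic Einstein--Yang--Mills system (the ODE system given in the context), with a regular nonextremal event horizon at $r=r_h$, and with $N>0$ and $S>0$ for all $r>r_h$. Suppose the solution is asymptotically flat and magnetically neutral with $$w(\infty):=\lim_{r\to\infty}w(r)=\varepsilon .$$ If $\varepsilon\, w(r)>0$ for every $r$ outside the event horizon, then $w(r)\equiv\varepsilon$ for all $r$ outside the event horizon.
   Context: All functions are real-valued functions of the dimensionless radial coordinate $r$; a prime denotes $d/dr$. The unknowns are the mass function $m(r)$, the redshift function $S(r)$ and the gauge amplitude $w(r)$. They describe the metric $ds^2=-N S^2\,dt^2+dr^2/N+r^2(d\theta^2+\sin^2\theta\,d\phi^2)$ coupled to a purely magnetic $SU(2)$ gauge field with logarithmic nonlinear Lagrangian. Set $$N=1-\frac{2m}{r},\qquad X=\frac{N w'^2}{r^2}+\frac{(1-w^2)^2}{2r^4},\qquad P=\frac{1}{1+X/b^2},$$ where $b>0$ is the (dimensionless) nonlinearity parameter. Reduced system. The equations, for $r>r_h$, are $$m'=r^2b^2\ln\!\left(1+\frac{X}{b^2}\right),\qquad \frac{S'}{S}=\frac{2Pw'^2}{r},\qquad \left(S N P w'\right)'=\frac{SP}{r^2}\,w(w^2-1).$$ Regular nonextremal event horizon at $r=r_h$. This means $N(r_h)=0$ (equivalently $m(r_h)=r_h/2$) and $N'(r_h)>0$, and the functions $m,S,w$ are analytic at $r=r_h$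 with $S(r_h)>0$; in particular $w$ and $w'$ are finite at $r_h$. Exterior. "Outside the event horizon" means $r>r_h$. In the exterior $N>0$ and $S>0$; hence $X\ge 0$ and $0<P\le 1$ there. Asymptotically flat. This means that as $r\to\infty$, $N(r)\to1$, $S(r)\to1$ and $m(r)\to M$ for some finite real number $M$. Magnetically neutral. This means $w$ tends at infinity to one of the pure-gauge vacuum values $\pm1$ (as opposed to $w(\infty)=0$). *)

theory Defs
  imports "HOL-Analysis.Analysis"
begin

definition lapse :: "(real \<Rightarrow> real) \<Rightarrow> real \<Rightarrow> real" where
  "lapse m r = 1 - 2 * m r / r"

definition field_X :: "(real \<Rightarrow> real) \<Rightarrow> (real \<Rightarrow> real) \<Rightarrow> real \<Rightarrow> real" where
  "field_X m w r =
     lapse m r * (deriv w r)\<^sup>2 / r\<^sup>2 + (1 - (w r)\<^sup>2)\<^sup>2 / (2 * r ^ 4)"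

definition field_P :: "real \<Rightarrow> (real \<Rightarrow> real) \<Rightarrow> (real \<Rightarrow> real) \<Rightarrow> real \<Rightarrow> real" where
  "field_P b m w r = 1 / (1 + field_X m w r / b\<^sup>2)"

(* Differentiability is required explicitly, since deriv is a total operator. No further
   regularity of w is assumed: the last equation differentiates the product S N P w'
   as a whole. *)
definition log_EYM_solution ::
  "real \<Rightarrow> real \<Rightarrow> (real \<Rightarrow> real) \<Rightarrow> (real \<Rightarrow> real) \<Rightarrow> (real \<Rightarrow> real) \<Rightarrow> bool" where
  "log_EYM_solution b r\<^sub>h m S w \<longleftrightarrow>
     (\<forall>r>r\<^sub>h.
        m differentiable (at r) \<and> S differentiable (at r) \<and> w differentiable (at r) \<and>
        (\<lambda>x. S x * lapse m x * field_P b m w x * deriv w x) differentiable (at r) \<and>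
        deriv m r = r\<^sup>2 * b\<^sup>2 * ln (1 + field_X m w r / b\<^sup>2) \<and>
        deriv S r / S r = 2 * field_P b m w r * (deriv w r)\<^sup>2 / r \<and>
        deriv (\<lambda>x. S x * lapse m x * field_P b m w x * deriv w x) r =
          S r * field_P b m w r / r\<^sup>2 * (w r * ((w r)\<^sup>2 - 1)))"

(* Real analyticity at the left endpoint a of the domain {a..}: on some [a, a + d) the
   function agrees with a function that has a convergent power series expansion about a.
   Values of f to the left of a play no role. *)
definition analytic_at_left_end :: "(real \<Rightarrow> real) \<Rightarrow> real \<Rightarrow> bool" where
  "analytic_at_left_end f a \<longleftrightarrow>
     (\<exists>g F. (\<lambda>x. g (a + x)) has_fps_expansion F \<and>
            f a = g a \<and> (\<forall>\<^sub>F r in at_right a. f r = g r))"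

(* The derivative of the lapse at the horizon is one-sided, because the solution is only
   given for r \<ge> r\<^sub>h. *)
definition regular_nonextremal_horizon ::
  "real \<Rightarrow> (real \<Rightarrow> real) \<Rightarrow> (real \<Rightarrow> real) \<Rightarrow> (real \<Rightarrow> real) \<Rightarrow> bool" where
  "regular_nonextremal_horizon r\<^sub>h m S w \<longleftrightarrow>
     lapse m r\<^sub>h = 0 \<and>
     (\<exists>D>0. (lapse m has_real_derivative D) (at r\<^sub>h within {r\<^sub>h..})) \<and>
     analytic_at_left_end m r\<^sub>h \<and> analytic_at_left_end S r\<^sub>h \<and> analytic_at_left_end w r\<^sub>h \<and>
     S r\<^sub>h > 0"

definition asymptotically_flat :: "(real \<Rightarrow> real) \<Rightarrow> (real \<Rightarrow> real) \<Rightarrow> bool" where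
  "asymptotically_flat m S \<longleftrightarrow>
     (lapse m \<longlongrightarrow> 1) at_top \<and> (S \<longlongrightarrow> 1) at_top \<and> (\<exists>M. (m \<longlongrightarrow> M) at_top)"

end

theory Submission
  imports Defs
begin

text \<open>
  Let \<open>F = S N P w'\<close> be the flux. Then \<open>H = F (w - \<epsilon>)\<close> satisfies
  \<open>H' = S P w (w + \<epsilon>) (w - \<epsilon>)\<^sup>2 / r\<^sup>2 + S N P w'\<^sup>2 \<ge> 0\<close>, because \<open>\<epsilon> w > 0\<close>, and
  \<open>H\<close> tends to \<open>0\<close> at the horizon, because \<open>N\<close> does while the other factors stay bounded.
  Hence \<open>H \<ge> 0\<close>, that is, \<open>(w - \<epsilon>) w' \<ge> 0\<close>. So \<open>(w - \<epsilon>)\<^sup>2\<close> is nondecreasing; since it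
  tends to \<open>0\<close> at infinity, it vanishes.
\<close>

lemma analytic_at_left_end_tendsto:
  assumes "analytic_at_left_end f a"
  shows "(f \<longlongrightarrow> f a) (at_right a)"
proof -
  obtain g F where F: "(\<lambda>x. g (a + x)) has_fps_expansion F"
    and fa: "f a = g a" and ev: "\<forall>\<^sub>F r in at_right a. f r = g r"
    using assms unfolding analytic_at_left_end_def by blast
  have "isCont (\<lambda>x. g (a + x)) 0"
    using has_fps_expansion_imp_continuous[OF F] by simp
  then have "isCont g a"
    by (simp add: isCont_def LIM_offset_zero_iff[where a = a])
  then have "(g \<longlongrightarrow> f a) (at_right a)"
    by (simp add: fa isCont_def filterlim_at_split)
  then show ?thesis
    using ev by (simp add: tendsto_cong)
qed

text \<open>Bounds \<open>w'\<close> near the horizon. The derivative of a convergent power series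
  is continuous at the centre, and \<open>deriv f\<close> agrees with it just to the right of
  \<open>a\<close>.\<close>

lemma analytic_at_left_end_deriv_tendsto:
  assumes "analytic_at_left_end f a"
  shows "\<exists>L. (deriv f \<longlongrightarrow> L) (at_right a)"
proof -
  obtain g F where F: "(\<lambda>x. g (a + x)) has_fps_expansion F"
    and ev: "\<forall>\<^sub>F r in at_right a. f r = g r"
    using assms unfolding analytic_at_left_end_def by blast
  \<comment> \<open>This holds at every point, differentiable or not: \<open>deriv\<close> chooses a
    value by a predicate that \<open>DERIV_shift\<close> makes the same on both sides.\<close>
  have "deriv (\<lambda>x. g (a + x)) = (\<lambda>x. deriv g (a + x))"
    by (auto simp: fun_eq_iff deriv_def DERIV_shift add.commute[of a])
  then have "isCont (\<lambda>x. deriv g (a + x)) 0"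
    using has_fps_expansion_imp_continuous[OF has_fps_expansion_deriv[OF F]] by simp
  then have "isCont (deriv g) a"
    by (simp add: isCont_def LIM_offset_zero_iff[where a = a])
  then have lim: "(deriv g \<longlongrightarrow> deriv g a) (at_right a)"
    by (simp add: isCont_def filterlim_at_split)
  obtain d where d: "d > a" "\<And>r. a < r \<Longrightarrow> r < d \<Longrightarrow> f r = g r"
    using ev unfolding eventually_at_right_field by blast
  have "deriv f r = deriv g r" if "a < r" "r < d" for r
  proof (rule deriv_cong_ev)
    \<comment> \<open>\<open>deriv\<close> is two-sided, so agreement is needed on both sides of
      \<open>r\<close>; the open interval provides it.\<close>
    have "\<forall>\<^sub>F x in nhds r. x \<in> {a<..<d}"
      by (rule eventually_nhds_in_open) (use that in auto)
    then show "\<forall>\<^sub>F x in nhds r. f x = g x"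
      by eventually_elim (use d in auto)
  qed simp
  then have "\<forall>\<^sub>F r in at_right a. deriv f r = deriv g r"
    using d(1) unfolding eventually_at_right_field by blast
  with lim show ?thesis
    by (auto simp: tendsto_cong)
qed

lemma field_X_nonneg:
  assumes "lapse m r \<ge> 0"
  shows "field_X m w r \<ge> 0"
  using assms unfolding field_X_def by simp

lemma field_P_pos_le_one:
  assumes "lapse m r \<ge> 0"
  shows "0 < field_P b m w r" "field_P b m w r \<le> 1"
proof -
  have "0 \<le> field_X m w r / b\<^sup>2"
    using field_X_nonneg[OF assms] by simp
  then show "0 < field_P b m w r" "field_P b m w r \<le> 1"
    unfolding field_P_def by (simp_all add: add_pos_nonneg)
qed

text \<open>The lapse tends to 0 while \<open>S\<close> and \<open>w'\<close> have finite limits.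
  For \<open>P\<close> only the bound 0 < P \<le> 1 is used, so the limit comes from comparison with
  the product without \<open>P\<close>.\<close>

lemma flux_tendsto_zero_at_horizon:
  assumes horizon: "regular_nonextremal_horizon a m S w"
    and N: "\<And>r. r > a \<Longrightarrow> lapse m r \<ge> 0"
  shows "((\<lambda>r. S r * lapse m r * field_P b m w r * deriv w r) \<longlongrightarrow> 0) (at_right a)"
proof -
  have N0: "lapse m a = 0" and an: "analytic_at_left_end S a" "analytic_at_left_end w a"
    using horizon unfolding regular_nonextremal_horizon_def by auto
  obtain D where "(lapse m has_real_derivative D) (at a within {a..})"
    using horizon unfolding regular_nonextremal_horizon_def by blast
  then have "(lapse m \<longlongrightarrow> lapse m a) (at a within {a..})"
    using DERIV_continuous continuous_within by blast
  then have limN: "(lapse m \<longlongrightarrow> 0) (at_right a)"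
    unfolding N0 by (rule tendsto_within_subset) auto
  obtain L where L: "(deriv w \<longlongrightarrow> L) (at_right a)"
    using analytic_at_left_end_deriv_tendsto[OF an(2)] by blast
  have lim: "((\<lambda>r. \<bar>S r * lapse m r * deriv w r\<bar>) \<longlongrightarrow> 0) (at_right a)"
    using tendsto_rabs[OF tendsto_mult[OF tendsto_mult[OF analytic_at_left_end_tendsto[OF an(1)] limN] L]]
    by simp
  have "\<forall>\<^sub>F r in at_right a. norm (S r * lapse m r * field_P b m w r * deriv w r)
          \<le> \<bar>S r * lapse m r * deriv w r\<bar>"
    unfolding eventually_at_right_field
  proof (intro exI[of _ "a + 1"] conjI allI impI)
    fix r assume "a < r"
    then have "\<bar>field_P b m w r\<bar> \<le> 1"
      using field_P_pos_le_one[OF N, of r b w] by simp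
    then have "\<bar>S r * lapse m r * deriv w r\<bar> * \<bar>field_P b m w r\<bar> \<le> \<bar>S r * lapse m r * deriv w r\<bar>"
      by (intro mult_left_le) auto
    then show "norm (S r * lapse m r * field_P b m w r * deriv w r)
          \<le> \<bar>S r * lapse m r * deriv w r\<bar>"
      by (simp add: abs_mult mult_ac)
  qed simp
  then show ?thesis
    using lim by (rule Lim_null_comparison)
qed

text \<open>\<open>H\<close> is nondecreasing on the open ray, so \<open>H r\<close> bounds
  \<open>H x\<close> for all x in (a, r); let x tend to a. Only the limit at \<open>a\<close>
  enters, not the value \<open>H a\<close>: at the horizon the flux would contain the two-sided
  \<open>deriv w\<close>.\<close>

lemma nonneg_of_deriv_nonneg_at_right:
  fixes H :: "real \<Rightarrow> real"
  assumes deriv: "\<And>r. r > a \<Longrightarrow> (H has_real_derivative H' r) (at r)"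
    and nonneg: "\<And>r. r > a \<Longrightarrow> H' r \<ge> 0"
    and lim: "(H \<longlongrightarrow> 0) (at_right a)"
    and "r > a"
  shows "H r \<ge> 0"
proof (rule tendsto_upperbound[OF lim])
  have "H x \<le> H r" if "a < x" "x < r" for x
  proof (rule DERIV_nonneg_imp_nondecreasing[of x r H])
    fix y assume "x \<le> y"
    then have "y > a"
      using that by simp
    then show "\<exists>d. (H has_real_derivative d) (at y) \<and> d \<ge> 0"
      using deriv nonneg by blast
  qed (use that in simp)
  then show "\<forall>\<^sub>F x in at_right a. H x \<le> H r"
    using \<open>r > a\<close> unfolding eventually_at_right_field by blast
qed simp

text \<open>Mirror image at infinity: a nondecreasing function stays below its limit.\<close>

lemma nonpos_of_deriv_nonneg_at_top:
  fixes H :: "real \<Rightarrow> real"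
  assumes deriv: "\<And>r. r > a \<Longrightarrow> (H has_real_derivative H' r) (at r)"
    and nonneg: "\<And>r. r > a \<Longrightarrow> H' r \<ge> 0"
    and lim: "(H \<longlongrightarrow> 0) at_top"
    and "r > a"
  shows "H r \<le> 0"
proof (rule tendsto_lowerbound[OF lim])
  have "H r \<le> H x" if "r \<le> x" for x
  proof (rule DERIV_nonneg_imp_nondecreasing[of r x H])
    fix y assume "r \<le> y"
    then have "y > a"
      using that \<open>r > a\<close> by simp
    then show "\<exists>d. (H has_real_derivative d) (at y) \<and> d \<ge> 0"
      using deriv nonneg by blast
  qed (use that in simp)
  then show "\<forall>\<^sub>F x in at_top. H r \<le> H x"
    unfolding eventually_at_top_linorder by blast
qed simp

theorem proposition1:
  fixes b r\<^sub>h \<epsilon> :: real and m S w :: "real \<Rightarrow> real"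
  assumes b: "b > 0" and rh: "r\<^sub>h > 0" and eps: "\<epsilon> \<in> {1, -1}"
    and solution: "log_EYM_solution b r\<^sub>h m S w"
    and horizon: "regular_nonextremal_horizon r\<^sub>h m S w"
    and exterior: "\<And>r. r > r\<^sub>h \<Longrightarrow> lapse m r > 0 \<and> S r > 0"
    and flat: "asymptotically_flat m S"
    and neutral: "(w \<longlongrightarrow> \<epsilon>) at_top"
    and sign: "\<And>r. r > r\<^sub>h \<Longrightarrow> \<epsilon> * w r > 0"
  shows "\<forall>r>r\<^sub>h. w r = \<epsilon>"
proof -
  define F where "F = (\<lambda>x. S x * lapse m x * field_P b m w x * deriv w x)"
  \<comment> \<open>The right-hand side of the gauge field equation. \<open>F\<close> is
    differentiated as a whole, so no second derivative of \<open>w\<close> appears.\<close>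
  define F' where "F' = (\<lambda>r. S r * field_P b m w r / r\<^sup>2 * (w r * ((w r)\<^sup>2 - 1)))"
  have Npos: "lapse m r > 0" "lapse m r \<ge> 0" and Spos: "S r > 0" if "r > r\<^sub>h" for r
    using exterior[OF that] by simp_all
  have dw: "(w has_real_derivative deriv w r) (at r)" if "r > r\<^sub>h" for r
    using solution that unfolding log_EYM_solution_def
    by (auto simp: DERIV_deriv_iff_real_differentiable)
  have dF: "(F has_real_derivative F' r) (at r)" if "r > r\<^sub>h" for r
  proof -
    have "F differentiable (at r)" "deriv F r = F' r"
      using solution that unfolding log_EYM_solution_def F_def F'_def by blast+
    then show ?thesis
      by (metis DERIV_deriv_iff_real_differentiable)
  qed
  have eps2: "\<epsilon>\<^sup>2 = 1"
    using eps by auto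
  have H_nonneg: "F r * (w r - \<epsilon>) \<ge> 0" if "r > r\<^sub>h" for r
  proof (rule nonneg_of_deriv_nonneg_at_right[OF _ _ _ that])
    fix r assume r: "r > r\<^sub>h"
    show "((\<lambda>r. F r * (w r - \<epsilon>)) has_real_derivative
        F' r * (w r - \<epsilon>) + F r * deriv w r) (at r)"
      by (auto intro!: derivative_eq_intros dF dw r)
    have P: "field_P b m w r > 0"
      by (rule field_P_pos_le_one(1)[OF Npos(2)[OF r]])
    \<comment> \<open>Writing 1 as \<open>\<epsilon>\<^sup>2\<close> lets one factorization serve
      both vacua. The sign hypothesis makes the factor w (w + \<epsilon>) positive.\<close>
    have "w r * ((w r)\<^sup>2 - \<epsilon>\<^sup>2) * (w r - \<epsilon>) = ((w r)\<^sup>2 + \<epsilon> * w r) * (w r - \<epsilon>)\<^sup>2"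
      by (simp add: power2_eq_square algebra_simps)
    also have "\<dots> \<ge> 0"
      using sign[OF r] by simp
    finally have "w r * ((w r)\<^sup>2 - 1) * (w r - \<epsilon>) \<ge> 0"
      unfolding eps2 .
    then have "S r * field_P b m w r / r\<^sup>2 * (w r * ((w r)\<^sup>2 - 1) * (w r - \<epsilon>)) \<ge> 0"
      using P Spos[OF r] by (intro mult_nonneg_nonneg[of "S r * field_P b m w r / r\<^sup>2"]) simp_all
    then have "F' r * (w r - \<epsilon>) \<ge> 0"
      unfolding F'_def by (simp only: mult.assoc)
    moreover have "F r * deriv w r = S r * lapse m r * field_P b m w r * (deriv w r)\<^sup>2"
      unfolding F_def by (simp add: power2_eq_square)
    moreover have "\<dots> \<ge> 0"
      using P Spos[OF r] Npos(2)[OF r] by simp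
    ultimately show "F' r * (w r - \<epsilon>) + F r * deriv w r \<ge> 0"
      by simp
  next
    have "(F \<longlongrightarrow> 0) (at_right r\<^sub>h)"
      unfolding F_def by (rule flux_tendsto_zero_at_horizon[OF horizon Npos(2)])
    moreover have "(w \<longlongrightarrow> w r\<^sub>h) (at_right r\<^sub>h)"
      using horizon unfolding regular_nonextremal_horizon_def
      by (intro analytic_at_left_end_tendsto) simp
    ultimately show "((\<lambda>r. F r * (w r - \<epsilon>)) \<longlongrightarrow> 0) (at_right r\<^sub>h)"
      by (auto intro!: tendsto_eq_intros)
  qed
  have "(w r - \<epsilon>)\<^sup>2 \<le> 0" if "r > r\<^sub>h" for r
  proof (rule nonpos_of_deriv_nonneg_at_top[OF _ _ _ that])
    fix r assume r: "r > r\<^sub>h"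
    show "((\<lambda>r. (w r - \<epsilon>)\<^sup>2) has_real_derivative 2 * (w r - \<epsilon>) * deriv w r) (at r)"
      by (auto intro!: derivative_eq_intros dw r)
    \<comment> \<open>Dividing \<open>H_nonneg\<close> by this positive factor leaves (w -
      \<epsilon>) w' \<ge> 0, half the derivative of the square.\<close>
    have "S r * lapse m r * field_P b m w r > 0"
      using Npos[OF r] Spos[OF r] field_P_pos_le_one(1) by simp
    moreover have "S r * lapse m r * field_P b m w r * ((w r - \<epsilon>) * deriv w r) \<ge> 0"
      using H_nonneg[OF r] unfolding F_def by (simp add: mult_ac)
    ultimately show "2 * (w r - \<epsilon>) * deriv w r \<ge> 0"
      by (simp add: zero_le_mult_iff)
  next
    show "((\<lambda>r. (w r - \<epsilon>)\<^sup>2) \<longlongrightarrow> 0) at_top"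
      by (rule tendsto_eq_intros neutral refl | simp)+
  qed
  then show ?thesis
    by simp
qed

end
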